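(* There exist a real number $\rho>1$ and a sequence $\{n_k,\ k\ge 1\}$ of positive integers with $n_k\ge \rho^k$ for all $k\ge 1$, such that the following holds. For every $\varepsilon>0$ there is a constant $C_\varepsilon>0$, depending only on $\varepsilon$, such that for every finite non-negative (Borel) measure $\nu$ on $\mathbb{R}$ whose Fourier transform $\widehat\nu$ satisfies $\widehat\nu(t)\ge 0$ for all $t\in\mathbb{R}$, every $T>0$ and every $k\ge 1$, $$\int_{-2^{n_k}T}^{2^{n_k}T}\widehat\nu(x)\,dx\ \le\ C_\varepsilon\, T\,2^{2^{(1+\varepsilon)n_k}}\int_{\mathbb{R}}\Big|\frac{\sin(xT)}{xT}\Big|^{n_k^2}\,\nu(dx).$$
   Context: For a finite measure $\nu$ on $\mathbb{R}$, $\widehat\nu(t)=\int_{\mathbb{R}}e^{itx}\,\nu(dx)$. The condition $\widehat\nu\ge 0$ means that $\widehat\nu$ is real-valued and non-negative everywhere. The quotient $\frac{\sin u}{u}$ is read as $1$ at $u=0$. *)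

theory Defs
  imports "HOL-Probability.Probability"
begin

end

theory Submission
  imports Defs
begin

text \<open>
  Why the theorem holds. Put \<open>\<phi> = Re (char \<nu>) \<ge> 0\<close>, and for a natural number \<open>m\<close> let
  \<open>J\<^sub>m a\<close> be the integral of \<open>cos (a x) sinc (x T) ^ m\<close> against \<open>\<nu>\<close>, so that \<open>J\<^sub>0 = \<phi>\<close>.
  Multiplying the weight by \<open>sinc (x T)\<close> amounts, on the Fourier side, to averaging over a
  window of half-length \<open>T\<close>:
  \<open>2 T J\<^sub>m\<^sub>+\<^sub>1 a\<close> is the integral of \<open>J\<^sub>m\<close> over \<open>{a - T..a + T}\<close>
  (lemma \<open>window_integral_cos_transform\<close>). Two consequences are combined.

  \<^item> Averages of a non-negative function are non-negative, so every \<open>J\<^sub>m\<close> is. Moreover, averaging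
    loses at most half of the mass in each window \<open>{a - T..a + T}\<close>
    (lemma \<open>window_average_keeps_half\<close>), because the window
    around any point of the left half contains that whole left half, and likewise on the right.
    Iterating, the integral of \<open>\<phi>\<close> over \<open>{a - T..a + T}\<close> is at most \<open>2 ^ m T J\<^sub>m a\<close> for \<open>m \<ge> 1\<close>.

  \<^item> Trivially \<open>J\<^sub>m a \<le> R\<close>, where \<open>R\<close> is the integral of \<open>\<bar>sinc (x T)\<bar> ^ m\<close>; this bound does not
    depend on \<open>a\<close>. It is what carries the estimate from the window around the origin, which
    \<open>R\<close> naturally controls, to all other windows.

  Covering \<open>{- 2 ^ n T..2 ^ n T}\<close> by \<open>2 ^ n\<close> windows and taking \<open>m = n\<^sup>2\<close> gives the bound
  \<open>2 ^ (n + n\<^sup>2) T R\<close> for every \<open>n \<ge> 1\<close> (lemma \<open>char_integral_le_sinc_power\<close>). Since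
  \<open>n + n\<^sup>2 \<le> 2 ^ n + 4\<close>, the factor is at most \<open>2 ^ 4\<close> times the doubly exponential one, even at
  \<open>\<epsilon> = 0\<close>: the constant \<open>2 ^ 4\<close> serves all \<open>\<epsilon>\<close>, and the sequence may be \<open>n\<^sub>k = 2 ^ k\<close>, with \<open>\<rho> = 2\<close>.
\<close>

section \<open>Windows on the real line\<close>

text \<open>The two halves of the window are treated separately: for \<open>s\<close> in the left half,
  \<open>{s - T..s + T}\<close> contains the left half, which bounds \<open>g s\<close> below by a constant there.\<close>

lemma window_average_keeps_half:
  fixes f g :: "real \<Rightarrow> real"
  assumes "T > 0" and f: "continuous_on UNIV f" "\<And>x. f x \<ge> 0" and g: "continuous_on UNIV g"
    and avg: "\<And>a. integral {a - T..a + T} f = 2 * T * g a"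
  shows "integral {a - T..a + T} f \<le> 2 * integral {a - T..a + T} g"
proof -
  have fi: "f integrable_on {u..v}" and gi: "g integrable_on {u..v}" for u v
    using f(1) g by (auto intro!: integrable_continuous_real intro: continuous_on_subset)
  have half: "integral {u..u + T} f \<le> 2 * integral {u..u + T} g" for u
  proof -
    have "integral {u..u + T} f / (2 * T) \<le> g s" if "s \<in> {u..u + T}" for s
    proof -
      have "integral {u..u + T} f \<le> integral {s - T..s + T} f"
        using that f(2) by (intro integral_subset_le fi) auto
      then show ?thesis
        using avg[of s] \<open>T > 0\<close> by (simp add: field_simps)
    qed
    then have "integral {u..u + T} (\<lambda>_. integral {u..u + T} f / (2 * T)) \<le> integral {u..u + T} g"
      by (intro integral_le gi) auto
    then show ?thesis
      using \<open>T > 0\<close> by (simp add: field_simps)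
  qed
  have split: "integral {a - T..a + T} h = integral {a - T..a - T + T} h + integral {a..a + T} h"
    if "\<And>u v. h integrable_on {u..v}" for h :: "real \<Rightarrow> real"
    using Henstock_Kurzweil_Integration.integral_combine[of "a - T" a "a + T" h] that \<open>T > 0\<close> by simp
  show ?thesis
    using half[of "a - T"] half[of a] split[OF fi] split[OF gi] by simp
qed

lemma integral_le_window_count:
  fixes f :: "real \<Rightarrow> real"
  assumes "T > 0" and f: "continuous_on UNIV f"
    and bound: "\<And>a. integral {a - T..a + T} f \<le> K"
  shows "integral {b..b + real N * (2 * T)} f \<le> real N * K"
proof (induction N)
  case 0
  then show ?case by simp
next
  case (Suc N)
  define c where "c = b + real N * (2 * T)"
  have "integral {b..b + real (Suc N) * (2 * T)} f = integral {b..c} f + integral {c..c + 2 * T} f"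
    using Henstock_Kurzweil_Integration.integral_combine[of b c "c + 2 * T" f] f \<open>T > 0\<close>
    by (simp add: c_def algebra_simps integrable_continuous_real continuous_on_subset)
  moreover have "integral {c..c + 2 * T} f \<le> K"
    using bound[of "c + T"] by (simp add: algebra_simps)
  ultimately show ?case
    using Suc by (simp add: c_def algebra_simps)
qed

section \<open>Cosine transforms and the sinc kernel\<close>

lemma abs_sinc_le_one: "\<bar>sinc x\<bar> \<le> 1"
  using abs_sin_x_le_abs_x[of x] by (simp add: divide_le_eq_1)

lemma integral_cos_window:
  fixes T x a :: real
  assumes "T > 0"
  shows "integral {a - T..a + T} (\<lambda>s. cos (s * x)) = 2 * T * (cos (a * x) * sinc (x * T))"
proof (cases "x = 0")
  case True
  then show ?thesis using assms by simp
next
  case False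
  have "((\<lambda>s. cos (s * x)) has_integral sin ((a + T) * x) / x - sin ((a - T) * x) / x) {a - T..a + T}"
    using assms False
    by (intro fundamental_theorem_of_calculus)
       (auto intro!: derivative_eq_intros simp flip: has_real_derivative_iff_has_vector_derivative)
  then have "integral {a - T..a + T} (\<lambda>s. cos (s * x)) = (sin ((a + T) * x) - sin ((a - T) * x)) / x"
    by (simp add: integral_unique diff_divide_distrib)
  also have "\<dots> = 2 * T * (cos (a * x) * sinc (x * T))"
    using False assms by (simp add: sin_add sin_diff ring_distribs mult.commute)
  finally show ?thesis .
qed

text \<open>The real part of the Fourier transform of the signed measure with density \<open>w\<close> against \<open>\<nu>\<close>.\<close>

definition cos_transform :: "real measure \<Rightarrow> (real \<Rightarrow> real) \<Rightarrow> real \<Rightarrow> real" where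
  "cos_transform \<nu> w a = (LINT x|\<nu>. cos (a * x) * w x)"

lemma (in finite_borel_measure) integrable_cos_mult:
  assumes [measurable]: "w \<in> borel_measurable borel" and w: "\<And>x. \<bar>w x\<bar> \<le> 1"
  shows "integrable M (\<lambda>x. cos (a * x) * w x)"
proof -
  note M_is_borel[measurable_cong]
  have "\<bar>cos (a * x) * w x\<bar> \<le> 1" for x
    using mult_mono[OF abs_cos_le_one w[of x]] by (simp add: abs_mult)
  then show ?thesis
    by (intro integrable_const_bound[where B = 1]) auto
qed

lemma (in finite_borel_measure) Re_char_eq_cos_transform:
  "Re (char M t) = cos_transform M (\<lambda>_. 1) t"
proof -
  note M_is_borel[measurable_cong]
  have "integrable M (\<lambda>x. iexp (t * x))"
    by (intro integrable_const_bound[where B = 1]) auto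
  then have "Re (char M t) = (LINT x|M. Re (iexp (t * x)))"
    unfolding char_def by (rule integral_Re[symmetric])
  then show ?thesis
    by (simp add: cos_transform_def Re_exp)
qed

lemma (in finite_borel_measure) continuous_on_cos_transform:
  assumes [measurable]: "w \<in> borel_measurable borel" and w: "\<And>x. \<bar>w x\<bar> \<le> 1"
  shows "continuous_on A (cos_transform M w)"
proof (rule continuous_at_imp_continuous_on, rule ballI)
  note M_is_borel[measurable_cong]
  fix a
  have "\<bar>cos (b * x) * w x\<bar> \<le> 1" for b x
    using mult_mono[OF abs_cos_le_one w[of x]] by (simp add: abs_mult)
  then show "isCont (cos_transform M w) a"
    unfolding continuous_at_sequentially cos_transform_def comp_def
    by (auto intro!: integral_dominated_convergence[where w = "\<lambda>_. 1"] tendsto_intros)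
qed

text \<open>Fubini: the \<open>s\<close>-integral of \<open>cos (s x)\<close> over the window can be taken first, and it produces
  the factor \<open>sinc (x T)\<close>.\<close>

lemma (in finite_borel_measure) window_integral_cos_transform:
  assumes [measurable]: "w \<in> borel_measurable borel" and w: "\<And>x. \<bar>w x\<bar> \<le> 1" and "T > 0"
  shows "integral {a - T..a + T} (cos_transform M w)
    = 2 * T * cos_transform M (\<lambda>x. w x * sinc (x * T)) a"
proof -
  note M_is_borel[measurable_cong]
  interpret pair_sigma_finite M lborel ..
  define I where "I = {a - T..a + T}"
  have [measurable]: "I \<in> sets borel" by (simp add: I_def)
  have le1: "\<bar>cos (s * x) * w x\<bar> \<le> 1" for s x
    using mult_mono[OF abs_cos_le_one w[of x]] by (simp add: abs_mult)
  have fin: "integrable (M \<Otimes>\<^sub>M lborel) (\<lambda>(x, s). indicator I s * (cos (s * x) * w x))"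
  proof (rule integrableI_bounded_set[where A = "space M \<times> I" and B = 1])
    show "emeasure (M \<Otimes>\<^sub>M lborel) (space M \<times> I) < \<infinity>"
      using \<open>T > 0\<close> finite_emeasure_space
      by (subst lborel.emeasure_pair_measure_Times)
         (auto simp: I_def ennreal_mult_eq_top_iff less_top[symmetric])
    show "AE z in M \<Otimes>\<^sub>M lborel. z \<in> space M \<times> I \<longrightarrow>
        norm (case z of (x, s) \<Rightarrow> indicator I s * (cos (s * x) * w x)) \<le> 1"
      using le1 by (intro AE_I2) (auto simp: indicator_def)
    show "AE z in M \<Otimes>\<^sub>M lborel. z \<notin> space M \<times> I \<longrightarrow>
        (case z of (x, s) \<Rightarrow> indicator I s * (cos (s * x) * w x)) = 0"
      by (intro AE_I2) (auto simp: space_pair_measure split: split_indicator_asm)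
  qed measurable
  have HK: "(LINT s|lborel. indicator I s * h s) = integral I h" if "continuous_on I h" for h :: "real \<Rightarrow> real"
    using set_borel_integral_eq_integral(2)[OF borel_integrable_atLeastAtMost'[of "a - T" "a + T" h]]
      that by (simp add: I_def set_lebesgue_integral_def)
  have "integral I (cos_transform M w) = (LINT s|lborel. indicator I s * cos_transform M w s)"
    by (rule HK[symmetric]) (rule continuous_on_cos_transform[OF assms(1) w])
  also have "\<dots> = (LINT s|lborel. LINT x|M. indicator I s * (cos (s * x) * w x))"
    by (simp add: cos_transform_def)
  also have "\<dots> = (LINT x|M. LINT s|lborel. indicator I s * (cos (s * x) * w x))"
    by (rule Fubini_integral[OF fin])
  also have "\<dots> = (LINT x|M. 2 * T * (cos (a * x) * (w x * sinc (x * T))))"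
  proof (rule Bochner_Integration.integral_cong[OF refl])
    fix x
    have "(LINT s|lborel. indicator I s * (cos (s * x) * w x)) = integral I (\<lambda>s. cos (s * x) * w x)"
      by (rule HK) (intro continuous_intros)
    also have "\<dots> = integral I (\<lambda>s. cos (s * x)) * w x"
      by simp
    also have "\<dots> = 2 * T * (cos (a * x) * (w x * sinc (x * T)))"
      unfolding I_def integral_cos_window[OF \<open>T > 0\<close>] by (simp only: mult_ac)
    finally show "(LINT s|lborel. indicator I s * (cos (s * x) * w x))
      = 2 * T * (cos (a * x) * (w x * sinc (x * T)))" .
  qed
  also have "\<dots> = 2 * T * cos_transform M (\<lambda>x. w x * sinc (x * T)) a"
    by (simp only: cos_transform_def integral_mult_right_zero)
  finally show ?thesis
    by (simp only: I_def)
qed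

section \<open>Measures with non-negative Fourier transform\<close>

text \<open>The right-hand side does not depend on \<open>a\<close>: the window averages of order \<open>m\<close> are cosine
  transforms with weight \<open>sinc (x T) ^ m\<close>, and these are bounded by the total mass of the
  absolute value of that weight. Non-negativity of the Fourier transform is what lets an average dominate
  the contribution of half a window.\<close>

lemma (in finite_borel_measure) char_window_le_sinc_power:
  assumes nonneg: "\<And>t. Re (char M t) \<ge> 0" and "T > 0" "m \<ge> 1"
  shows "integral {a - T..a + T} (\<lambda>t. Re (char M t))
    \<le> 2 ^ m * T * (LINT x|M. \<bar>sinc (x * T)\<bar> ^ m)"
proof -
  note M_is_borel[measurable_cong]
  define J where "J = (\<lambda>m. cos_transform M (\<lambda>x. sinc (x * T) ^ m))"
  have meas: "(\<lambda>x. sinc (x * T) ^ m) \<in> borel_measurable borel" for m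
    by measurable
  have le1: "\<bar>sinc (x * T) ^ m\<bar> \<le> 1" for x m
    using abs_sinc_le_one[of "x * T"] by (simp only: power_abs power_le_one abs_ge_zero)
  have cont: "continuous_on A (J m)" for A m
    unfolding J_def by (rule continuous_on_cos_transform[OF meas le1])
  have step: "integral {a - T..a + T} (J m) = 2 * T * J (Suc m) a" for m a
    unfolding J_def power_Suc2 by (rule window_integral_cos_transform[OF meas le1 \<open>T > 0\<close>])
  have J0: "J 0 = (\<lambda>t. Re (char M t))"
    by (simp add: J_def Re_char_eq_cos_transform fun_eq_iff)
  have J_nonneg: "J m t \<ge> 0" for m t
  proof (induction m arbitrary: t)
    case 0
    then show ?case using nonneg by (simp add: J0)
  next
    case (Suc m)
    then have "0 \<le> 2 * T * J (Suc m) t"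
      unfolding step[symmetric] by (intro integral_nonneg integrable_continuous_real cont) auto
    then show ?case
      using \<open>T > 0\<close> by (simp add: zero_le_mult_iff)
  qed
  have "integral {a - T..a + T} (J 0) \<le> 2 ^ j * integral {a - T..a + T} (J j)" for j
  proof (induction j)
    case (Suc j)
    have "integral {a - T..a + T} (J j) \<le> 2 * integral {a - T..a + T} (J (Suc j))"
      by (rule window_average_keeps_half[OF \<open>T > 0\<close> cont J_nonneg cont step])
    then have "2 ^ j * integral {a - T..a + T} (J j) \<le> 2 ^ j * (2 * integral {a - T..a + T} (J (Suc j)))"
      by (rule mult_left_mono) simp
    from order_trans[OF Suc this] show ?case
      by (simp only: power_Suc mult_ac)
  qed simp
  \<comment> \<open>The last of the \<open>m\<close> averagings is evaluated exactly at \<open>a\<close>, hence only \<open>m - 1\<close> halvings.\<close>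
  from this[of "m - 1"] have "integral {a - T..a + T} (J 0) \<le> 2 ^ m * T * J m a"
    using \<open>m \<ge> 1\<close> unfolding step by (cases m) (simp_all add: mult_ac)
  also have "J m a \<le> (LINT x|M. \<bar>sinc (x * T)\<bar> ^ m)"
    unfolding J_def cos_transform_def
  proof (rule integral_mono)
    show "integrable M (\<lambda>x. cos (a * x) * sinc (x * T) ^ m)"
      by (rule integrable_cos_mult[OF meas le1])
    show "integrable M (\<lambda>x. \<bar>sinc (x * T)\<bar> ^ m)"
      using integrable_abs[OF integrable_cos_mult[OF meas le1, of 0 m]]
      by (simp only: mult_zero_left cos_zero mult_1_left power_abs)
    fix x
    have "cos (a * x) * sinc (x * T) ^ m \<le> \<bar>cos (a * x)\<bar> * \<bar>sinc (x * T)\<bar> ^ m"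
      by (metis abs_ge_self abs_mult power_abs)
    also have "\<dots> \<le> \<bar>sinc (x * T)\<bar> ^ m"
      by (intro mult_left_le_one_le) auto
    finally show "cos (a * x) * sinc (x * T) ^ m \<le> \<bar>sinc (x * T)\<bar> ^ m" .
  qed
  finally show ?thesis
    using \<open>T > 0\<close> unfolding J0 by simp
qed

lemma (in finite_borel_measure) char_integral_le_sinc_power:
  assumes "\<And>t. Re (char M t) \<ge> 0" and "T > 0" "m \<ge> 1"
  shows "(LBINT x:{- (real N * T)..real N * T}. Re (char M x))
    \<le> real N * 2 ^ m * T * (LINT x|M. \<bar>sinc (x * T)\<bar> ^ m)"
proof -
  have cont: "continuous_on A (\<lambda>t. Re (char M t))" for A
    unfolding Re_char_eq_cos_transform by (rule continuous_on_cos_transform) auto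
  have "(LBINT x:{- (real N * T)..real N * T}. Re (char M x))
      = integral {- (real N * T)..- (real N * T) + real N * (2 * T)} (\<lambda>t. Re (char M t))"
    using set_borel_integral_eq_integral(2)[OF borel_integrable_atLeastAtMost'[OF cont]]
    by (simp add: algebra_simps)
  also have "\<dots> \<le> real N * (2 ^ m * T * (LINT x|M. \<bar>sinc (x * T)\<bar> ^ m))"
    by (rule integral_le_window_count[OF \<open>T > 0\<close> cont char_window_le_sinc_power[OF assms]])
  finally show ?thesis
    by (simp only: mult.assoc)
qed

section \<open>Comparison with the doubly exponential factor\<close>

lemma add_square_le_power_two: "n + n\<^sup>2 \<le> 2 ^ n + (4::nat)"
proof (cases "n \<ge> 5")
  case True
  then have "n + n\<^sup>2 \<le> 2 ^ n"
  proof (induction n rule: dec_induct)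
    case (step n)
    have "2 * n + 2 \<le> n + n\<^sup>2"
      using mult_le_mono1[OF step.hyps(1), of n] step.hyps(1) unfolding power2_eq_square by linarith
    then show ?case
      using step.IH by (simp add: power2_eq_square)
  qed (simp add: power2_eq_square)
  then show ?thesis by simp
next
  case False
  then have "n \<in> {0, 1, 2, 3, 4}" by auto
  then show ?thesis by (auto simp: power2_eq_square)
qed

lemma power_two_le_doubly_exponential:
  fixes \<epsilon> :: real
  assumes "\<epsilon> > 0"
  shows "real (2 ^ n) * 2 ^ n\<^sup>2 \<le> 2 ^ 4 * 2 powr (2 powr ((1 + \<epsilon>) * real n))"
proof -
  have "real (2 ^ n) * 2 ^ n\<^sup>2 = 2 ^ (n + n\<^sup>2)"
    by (simp add: power_add)
  also have "\<dots> \<le> 2 ^ (2 ^ n + 4)"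
    by (rule power_increasing[OF add_square_le_power_two]) simp
  also have "\<dots> = 2 ^ 4 * 2 powr (2 powr real n)"
    by (simp add: power_add powr_realpow[symmetric])
  also have "\<dots> \<le> 2 ^ 4 * 2 powr (2 powr ((1 + \<epsilon>) * real n))"
    using assms by (intro mult_left_mono powr_mono) (auto simp: algebra_simps)
  finally show ?thesis .
qed

theorem theorem1p1:
  shows "\<exists>(\<rho>::real) (n::nat \<Rightarrow> nat).
    \<rho> > 1 \<and>
    (\<forall>k\<ge>1. n k > 0 \<and> real (n k) \<ge> \<rho> ^ k) \<and>
    (\<forall>\<epsilon>::real. \<epsilon> > 0 \<longrightarrow>
      (\<exists>C::real. C > 0 \<and>
        (\<forall>(\<nu>::real measure) (T::real) (k::nat).
          finite_borel_measure \<nu> \<longrightarrow>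
          (\<forall>t::real. char \<nu> t \<in> \<real>\<^sub>\<ge>\<^sub>0) \<longrightarrow>
          T > 0 \<longrightarrow> k \<ge> 1 \<longrightarrow>
          (LBINT x:{- (2 ^ n k * T)..2 ^ n k * T}. Re (char \<nu> x))
            \<le> C * T * 2 powr (2 powr ((1 + \<epsilon>) * real (n k)))
                * (LINT x|\<nu>. \<bar>sinc (x * T)\<bar> ^ ((n k)\<^sup>2)))))"
proof (rule exI[of _ 2], rule exI[of _ "\<lambda>k. 2 ^ k"], intro conjI allI impI)
  fix \<epsilon> :: real
  assume "\<epsilon> > 0"
  show "\<exists>C::real. C > 0 \<and>
        (\<forall>(\<nu>::real measure) (T::real) (k::nat).
          finite_borel_measure \<nu> \<longrightarrow>
          (\<forall>t::real. char \<nu> t \<in> \<real>\<^sub>\<ge>\<^sub>0) \<longrightarrow>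
          T > 0 \<longrightarrow> k \<ge> 1 \<longrightarrow>
          (LBINT x:{- (2 ^ 2 ^ k * T)..2 ^ 2 ^ k * T}. Re (char \<nu> x))
            \<le> C * T * 2 powr (2 powr ((1 + \<epsilon>) * real (2 ^ k)))
                * (LINT x|\<nu>. \<bar>sinc (x * T)\<bar> ^ ((2 ^ k)\<^sup>2)))"
  proof (rule exI[of _ "2 ^ 4"], intro conjI allI impI)
    fix \<nu> :: "real measure" and T :: real and k :: nat
    assume \<nu>: "finite_borel_measure \<nu>" "\<forall>t. char \<nu> t \<in> \<real>\<^sub>\<ge>\<^sub>0" and "T > 0" "k \<ge> 1"
    define n :: nat where "n = 2 ^ k"
    define R where "R = (LINT x|\<nu>. \<bar>sinc (x * T)\<bar> ^ n\<^sup>2)"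
    have "R \<ge> 0"
      unfolding R_def by (rule Bochner_Integration.integral_nonneg) (rule zero_le_power[OF abs_ge_zero])
    have "(LBINT x:{- (real (2 ^ n) * T)..real (2 ^ n) * T}. Re (char \<nu> x))
        \<le> real (2 ^ n) * 2 ^ n\<^sup>2 * T * R"
      unfolding R_def
      by (rule finite_borel_measure.char_integral_le_sinc_power[OF \<nu>(1) _ \<open>T > 0\<close>])
         (use \<nu>(2) in \<open>auto simp: n_def complex_nonneg_Reals_iff\<close>)
    also have "\<dots> \<le> 2 ^ 4 * 2 powr (2 powr ((1 + \<epsilon>) * real n)) * T * R"
      using power_two_le_doubly_exponential[OF \<open>\<epsilon> > 0\<close>, of n] \<open>T > 0\<close> \<open>R \<ge> 0\<close>
      by (intro mult_right_mono) auto
    finally have "(LBINT x:{- (2 ^ n * T)..2 ^ n * T}. Re (char \<nu> x))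
        \<le> 2 ^ 4 * T * 2 powr (2 powr ((1 + \<epsilon>) * real n)) * R"
      by (simp only: of_nat_power of_nat_numeral mult_ac)
    then show "(LBINT x:{- (2 ^ 2 ^ k * T)..2 ^ 2 ^ k * T}. Re (char \<nu> x))
        \<le> 2 ^ 4 * T * 2 powr (2 powr ((1 + \<epsilon>) * real (2 ^ k)))
          * (LINT x|\<nu>. \<bar>sinc (x * T)\<bar> ^ ((2 ^ k)\<^sup>2))"
      unfolding R_def n_def .
  qed simp
qed auto

end
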